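(* Let $X$ be an F-$\mathbb{BC}$ module and let $p_{\mathbb{D}}$ be a countably subadditive hyperbolic semi-norm on $X$. Then $p_{\mathbb{D}}$ is continuous on $X$.
   Context: Bicomplex and hyperbolic numbers. $\mathbb{BC}=\{z_1+z_2 j : z_1,z_2\in\mathbb{C}(i)\}$ with $i^2=j^2=-1$, $ij=ji=k$ (so $k^2=1$); it is a commutative ring. $\mathbb{D}=\{\beta_1+k\beta_2:\beta_1,\beta_2\in\mathbb{R}\}\subset\mathbb{BC}$ is the ring of hyperbolic numbers. With $e_1=\frac{1+k}{2}$, $e_2=\frac{1-k}{2}$ one has $e_1^2=e_1$, $e_2^2=e_2$, $e_1+e_2=1$, $e_1e_2=0$, and each $Z\in\mathbb{BC}$ is uniquely $Z=e_1z_1+e_2z_2$ with $z_1,z_2\in\mathbb{C}(i)$; $Z\in\mathbb{D}$ iff $z_1,z_2$ are real. Put $|Z|_k=e_1|z_1|+e_2|z_2|$. Let $\mathbb{D}^+=\{e_1\alpha_1+e_2\alpha_2:\alpha_1,\alpha_2\ge 0\}$. The partial order on $\mathbb{D}$ is $\alpha\le\beta$ iff $\beta-\alpha\in\mathbb{D}^+$. Convergence in $\mathbb{D}$ is componentwise with respect to $e_1,e_2$. Norms and semi-norms. A hyperbolic semi-norm on a $\mathbb{BC}$-module $X$ is a map $p_{\mathbb{D}}:X\to\mathbb{D}^+$ with $p_{\mathbb{D}}(\mu x)=|\mu|_k\,p_{\mathbb{D}}(x)$ and $p_{\mathbb{D}}(x+y)\le p_{\mathbb{D}}(x)+p_{\mathbb{D}}(y)$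 for all $x,y\in X$, $\mu\in\mathbb{BC}$. A hyperbolic norm $\|\cdot\|_{\mathbb{D}}$ is a hyperbolic semi-norm that vanishes only at $x=0$. $x_n\to x$ means $\|x_n-x\|_{\mathbb{D}}\to 0$ in $\mathbb{D}$; a series converges to $x$ if its partial sums do. An F-$\mathbb{BC}$ module is a $\mathbb{BC}$-module with a hyperbolic norm for which every Cauchy sequence converges. Continuity of $p_{\mathbb{D}}$ means: $x_n\to x$ in $X$ implies $p_{\mathbb{D}}(x_n)\to p_{\mathbb{D}}(x)$ in $\mathbb{D}$. Countable subadditivity. $p_{\mathbb{D}}$ is countably subadditive if $p_{\mathbb{D}}\big(\sum_{k=1}^\infty x_k\big)\le\sum_{k=1}^\infty p_{\mathbb{D}}(x_k)$ for every convergent series $\sum_{k=1}^\infty x_k$ in $X$ for which $\sum_{k=1}^\infty p_{\mathbb{D}}(x_k)$ converges in $\mathbb{D}$. *)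

theory Defs
  imports Complex_Main
begin

section \<open>Bicomplex numbers\<close>

text \<open>\<open>Bicomplex z w\<close> stands for \<open>z + w j\<close> with \<open>z, w\<close> complex in the unit \<open>i\<close>.\<close>

datatype bicomplex = Bicomplex (bc_fst: complex) (bc_snd: complex)

instantiation bicomplex :: comm_ring_1
begin

definition "0 = Bicomplex 0 0"
definition "1 = Bicomplex 1 0"
definition "Z + W = Bicomplex (bc_fst Z + bc_fst W) (bc_snd Z + bc_snd W)"
definition "- Z = Bicomplex (- bc_fst Z) (- bc_snd Z)"
definition "Z - W = Bicomplex (bc_fst Z - bc_fst W) (bc_snd Z - bc_snd W)"
definition "Z * W = Bicomplex (bc_fst Z * bc_fst W - bc_snd Z * bc_snd W)
                              (bc_fst Z * bc_snd W + bc_snd Z * bc_fst W)"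

instance
  by standard
    (auto simp: zero_bicomplex_def one_bicomplex_def plus_bicomplex_def uminus_bicomplex_def
      minus_bicomplex_def times_bicomplex_def algebra_simps intro: bicomplex.expand)

end

definition bc_of_complex :: "complex \<Rightarrow> bicomplex" where
  "bc_of_complex z = Bicomplex z 0"

definition bc_of_real :: "real \<Rightarrow> bicomplex" where
  "bc_of_real a = bc_of_complex (complex_of_real a)"

definition bc_i :: bicomplex where "bc_i = bc_of_complex \<i>"
definition bc_j :: bicomplex where "bc_j = Bicomplex 0 1"
definition bc_k :: bicomplex where "bc_k = bc_i * bc_j"

definition bc_e1 :: bicomplex where "bc_e1 = bc_of_real (1/2) * (1 + bc_k)"
definition bc_e2 :: bicomplex where "bc_e2 = bc_of_real (1/2) * (1 - bc_k)"

text \<open>The components of \<open>Z = z + w j\<close> with respect to the idempotents: since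
  \<open>j = - i e1 + i e2\<close>, one has \<open>Z = e1 (z - i w) + e2 (z + i w)\<close>; see
  \<open>bc_idempotent_unique\<close> below.\<close>

definition bc_proj1 :: "bicomplex \<Rightarrow> complex" where
  "bc_proj1 Z = bc_fst Z - \<i> * bc_snd Z"

definition bc_proj2 :: "bicomplex \<Rightarrow> complex" where
  "bc_proj2 Z = bc_fst Z + \<i> * bc_snd Z"

definition bc_abs_k :: "bicomplex \<Rightarrow> bicomplex" where
  "bc_abs_k Z = bc_e1 * bc_of_real (cmod (bc_proj1 Z)) + bc_e2 * bc_of_real (cmod (bc_proj2 Z))"

lemmas bicomplex_defs =
  zero_bicomplex_def one_bicomplex_def plus_bicomplex_def uminus_bicomplex_def
  minus_bicomplex_def times_bicomplex_def bc_of_complex_def bc_of_real_def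
  bc_i_def bc_j_def bc_k_def bc_e1_def bc_e2_def bc_proj1_def bc_proj2_def

lemma bc_units: "bc_i * bc_i = -1" "bc_j * bc_j = -1" "bc_k * bc_k = 1"
  by (simp_all add: bicomplex_defs)

lemma bc_idempotents:
  "bc_e1 * bc_e1 = bc_e1" "bc_e2 * bc_e2 = bc_e2" "bc_e1 * bc_e2 = 0" "bc_e1 + bc_e2 = 1"
  by (simp_all add: bicomplex_defs complex_eq_iff)

lemma bc_idempotent_unique:
  "Z = bc_e1 * bc_of_complex z1 + bc_e2 * bc_of_complex z2 \<longleftrightarrow>
   z1 = bc_proj1 Z \<and> z2 = bc_proj2 Z"
  by (cases Z) (auto simp: bicomplex_defs complex_eq_iff field_simps)

section \<open>Hyperbolic numbers\<close>

definition hyperbolics :: "bicomplex set" where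
  "hyperbolics = {bc_of_real b1 + bc_k * bc_of_real b2 | b1 b2. True}"

definition hyperbolics_nonneg :: "bicomplex set" where
  "hyperbolics_nonneg = {bc_e1 * bc_of_real a1 + bc_e2 * bc_of_real a2 | a1 a2. 0 \<le> a1 \<and> 0 \<le> a2}"

definition hyp_le :: "bicomplex \<Rightarrow> bicomplex \<Rightarrow> bool" where
  "hyp_le a b \<longleftrightarrow> a \<in> hyperbolics \<and> b \<in> hyperbolics \<and> b - a \<in> hyperbolics_nonneg"

definition hyp_tendsto :: "('b \<Rightarrow> bicomplex) \<Rightarrow> bicomplex \<Rightarrow> 'b filter \<Rightarrow> bool" where
  "hyp_tendsto f l F \<longleftrightarrow>
     (\<forall>x. f x \<in> hyperbolics) \<and> l \<in> hyperbolics \<and>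
     ((\<lambda>x. bc_proj1 (f x)) \<longlongrightarrow> bc_proj1 l) F \<and> ((\<lambda>x. bc_proj2 (f x)) \<longlongrightarrow> bc_proj2 l) F"

definition hyp_sums :: "(nat \<Rightarrow> bicomplex) \<Rightarrow> bicomplex \<Rightarrow> bool" where
  "hyp_sums a s \<longleftrightarrow> hyp_tendsto (\<lambda>n. \<Sum>k<n. a k) s sequentially"

lemma hyperbolics_iff: "Z \<in> hyperbolics \<longleftrightarrow> bc_proj1 Z \<in> \<real> \<and> bc_proj2 Z \<in> \<real>"
proof
  assume "Z \<in> hyperbolics"
  then show "bc_proj1 Z \<in> \<real> \<and> bc_proj2 Z \<in> \<real>"
    by (auto simp: hyperbolics_def bicomplex_defs complex_is_Real_iff)
next
  assume "bc_proj1 Z \<in> \<real> \<and> bc_proj2 Z \<in> \<real>"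
  then have "Z = bc_of_real (Re (bc_fst Z)) + bc_k * bc_of_real (Im (bc_snd Z))"
    by (cases Z) (auto simp: bicomplex_defs complex_is_Real_iff complex_eq_iff)
  then show "Z \<in> hyperbolics"
    unfolding hyperbolics_def by blast
qed

section \<open>Modules over the bicomplex numbers\<close>

definition hyperbolic_seminorm ::
  "(bicomplex \<Rightarrow> 'a \<Rightarrow> 'a) \<Rightarrow> ('a::ab_group_add \<Rightarrow> bicomplex) \<Rightarrow> bool" where
  "hyperbolic_seminorm scale p \<longleftrightarrow>
     (\<forall>x. p x \<in> hyperbolics_nonneg) \<and>
     (\<forall>\<mu> x. p (scale \<mu> x) = bc_abs_k \<mu> * p x) \<and>
     (\<forall>x y. hyp_le (p (x + y)) (p x + p y))"

definition hyperbolic_norm ::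
  "(bicomplex \<Rightarrow> 'a \<Rightarrow> 'a) \<Rightarrow> ('a::ab_group_add \<Rightarrow> bicomplex) \<Rightarrow> bool" where
  "hyperbolic_norm scale N \<longleftrightarrow> hyperbolic_seminorm scale N \<and> (\<forall>x. N x = 0 \<longrightarrow> x = 0)"

definition hnorm_tendsto :: "('a::ab_group_add \<Rightarrow> bicomplex) \<Rightarrow> (nat \<Rightarrow> 'a) \<Rightarrow> 'a \<Rightarrow> bool" where
  "hnorm_tendsto N x l \<longleftrightarrow> hyp_tendsto (\<lambda>n. N (x n - l)) 0 sequentially"

definition hnorm_sums :: "('a::ab_group_add \<Rightarrow> bicomplex) \<Rightarrow> (nat \<Rightarrow> 'a) \<Rightarrow> 'a \<Rightarrow> bool" where
  "hnorm_sums N x s \<longleftrightarrow> hnorm_tendsto N (\<lambda>n. \<Sum>k<n. x k) s"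

definition hnorm_Cauchy :: "('a::ab_group_add \<Rightarrow> bicomplex) \<Rightarrow> (nat \<Rightarrow> 'a) \<Rightarrow> bool" where
  "hnorm_Cauchy N x \<longleftrightarrow>
     hyp_tendsto (\<lambda>(m, n). N (x m - x n)) 0 (sequentially \<times>\<^sub>F sequentially)"

locale F_BC_module = module scale
  for scale :: "bicomplex \<Rightarrow> 'a::ab_group_add \<Rightarrow> 'a" +
  fixes N :: "'a \<Rightarrow> bicomplex"
  assumes hyperbolic_norm: "hyperbolic_norm scale N"
    and complete: "hnorm_Cauchy N x \<Longrightarrow> \<exists>l. hnorm_tendsto N x l"

definition countably_subadditive ::
  "('a::ab_group_add \<Rightarrow> bicomplex) \<Rightarrow> ('a \<Rightarrow> bicomplex) \<Rightarrow> bool" where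
  "countably_subadditive N p \<longleftrightarrow>
     (\<forall>x s t. hnorm_sums N x s \<longrightarrow> hyp_sums (\<lambda>k. p (x k)) t \<longrightarrow> hyp_le (p s) t)"

definition hnorm_continuous ::
  "('a::ab_group_add \<Rightarrow> bicomplex) \<Rightarrow> ('a \<Rightarrow> bicomplex) \<Rightarrow> bool" where
  "hnorm_continuous N p \<longleftrightarrow>
     (\<forall>x l. hnorm_tendsto N x l \<longrightarrow> hyp_tendsto (\<lambda>n. p (x n)) (p l) sequentially)"

end

theory Submission
  imports Defs "HOL-Analysis.Urysohn"
begin

text \<open>
  Adding the two idempotent components turns \<open>N\<close> and \<open>p\<close> into a complete real norm and a real
  seminorm, and the latter is again countably subadditive. Zabreiko's lemma then bounds it by a
  multiple of the norm: by Baire some closure of a sublevel set contains a ball, which by convexity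
  and symmetry may be centred at \<open>0\<close>, so every \<open>x\<close> is the sum of a series whose seminorms decay
  geometrically. The reverse triangle inequality in each component finishes the proof.
\<close>

section \<open>Zabreiko's lemma\<close>

locale real_seminorm = vector_space scale
  for scale :: "real \<Rightarrow> 'a::ab_group_add \<Rightarrow> 'a" (infixr \<open>\<odot>\<close> 75) +
  fixes q :: "'a \<Rightarrow> real"
  assumes scale: "q (a \<odot> x) = \<bar>a\<bar> * q x"
    and triangle: "q (x + y) \<le> q x + q y"
begin

lemma zero [simp]: "q 0 = 0"
  using scale[of 0 0] by simp

lemma minus: "q (- x) = q x"
  using scale[of "-1" x] by simp

lemma minus_commute: "q (x - y) = q (y - x)"
  using minus[of "x - y"] by simp

lemma nonneg [simp]: "0 \<le> q x"
  using triangle[of x "- x"] by (simp add: minus)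

lemma triangle_diff: "q (x - y) \<le> q x + q y"
  using triangle[of x "- y"] by (simp add: minus)

lemma triangle_via: "q (x - z) \<le> q (x - y) + q (y - z)"
  using triangle[of "x - y" "y - z"] by simp

text \<open>Convexity and symmetry of sublevel sets in one inequality: half the difference of two
  members is again a member.\<close>

lemma half_diff: "q ((1/2) \<odot> (x - y)) \<le> (q x + q y) / 2"
  using triangle_diff[of x y] by (simp add: scale)

text \<open>The reverse triangle inequality gives
  \<open>\<bar>q y - q l\<bar> \<le> q (y - l) \<le> n (y - l)\<close>. Here \<open>n\<close> is an
  arbitrary function, so a constant multiple of a norm can be inserted directly.\<close>

lemma tendsto_of_bounded:
  assumes "\<And>x. q x \<le> n x" and "((\<lambda>i. n (x i - l)) \<longlongrightarrow> 0) F"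
  shows "((\<lambda>i. q (x i)) \<longlongrightarrow> q l) F"
proof -
  have "\<bar>q y - q l\<bar> \<le> n (y - l)" for y
    using triangle[of "y - l" l] triangle[of "l - y" y] minus_commute[of l y] assms(1)[of "y - l"]
    by simp
  then have "((\<lambda>i. q (x i) - q l) \<longlongrightarrow> 0) F"
    by (intro Lim_null_comparison[OF _ assms(2)]) simp
  then show ?thesis
    by (rule LIM_zero_cancel)
qed

end

text \<open>The Baire category half of the argument. It bounds \<open>q\<close> only on approximants
  of \<open>x\<close>, at a cost \<open>K * n x\<close> that does not depend on the precision
  \<open>r\<close>; this uniformity lets the approximation be iterated.\<close>

lemma Zabreiko_approximation:
  fixes scale :: "real \<Rightarrow> 'a::ab_group_add \<Rightarrow> 'a" (infixr \<open>\<odot>\<close> 75) and n q :: "'a \<Rightarrow> real"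
  assumes n: "real_seminorm scale n"
    and n_eq_0: "\<And>x. n x = 0 \<Longrightarrow> x = 0"
    and complete: "\<And>x :: nat \<Rightarrow> 'a.
      (\<And>e. e > 0 \<Longrightarrow> \<exists>M. \<forall>i\<ge>M. \<forall>j\<ge>M. n (x i - x j) < e) \<Longrightarrow> \<exists>l. (\<lambda>i. n (x i - l)) \<longlonglongrightarrow> 0"
    and q: "real_seminorm scale q"
  shows "\<exists>K\<ge>0. \<forall>x r. r > 0 \<longrightarrow> (\<exists>c. q c \<le> K * n x \<and> n (x - c) < r)"
proof -
  interpret n: real_seminorm scale n by (rule n)
  interpret q: real_seminorm scale q by (rule q)
  interpret M: Metric_space UNIV "\<lambda>x y. n (x - y)"
  proof
    show "n (x - y) = 0 \<longleftrightarrow> x = y" for x y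
      using n_eq_0[of "x - y"] by auto
  qed (auto simp: n.minus_commute n.triangle_via)
  have "M.mcomplete"
    unfolding M.mcomplete_def M.MCauchy_def M.limitin_metric_dist_null
    using complete by simp
  \<comment> \<open>Nothing makes the sublevel sets of \<open>q\<close> closed, so Baire is applied
    to their closures; hence the result concerns approximation by points of \<open>C k\<close> and
    not membership in it.\<close>
  define C where "C k = {x. q x \<le> real k}" for k :: nat
  define G where "G = range (\<lambda>k. M.mtopology closure_of (C k))"
  have "\<Union>G = UNIV"
  proof -
    have "x \<in> \<Union>G" for x
    proof -
      obtain k where "q x \<le> real k" using real_arch_simple by blast
      then have "x \<in> M.mtopology closure_of (C k)"
        using closure_of_subset[of "C k" M.mtopology] by (auto simp: C_def)
      then show ?thesis by (auto simp: G_def)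
    qed
    then show ?thesis by blast
  qed
  then have "M.mtopology interior_of \<Union>G \<noteq> {}"
    using interior_of_topspace[of M.mtopology] by simp
  moreover have "countable G" "\<And>T. T \<in> G \<Longrightarrow> closedin M.mtopology T"
    by (auto simp: G_def)
  \<comment> \<open>Baire in contrapositive form: countably many closed sets with empty interior
    cannot have a union with nonempty interior.\<close>
  ultimately obtain T where "T \<in> G" "M.mtopology interior_of T \<noteq> {}"
    using M.metric_Baire_category_alt[OF \<open>M.mcomplete\<close>, of G] by metis
  then obtain k x0 where "x0 \<in> M.mtopology interior_of (M.mtopology closure_of (C k))"
    by (auto simp: G_def)
  then obtain \<epsilon> where \<epsilon>: "\<epsilon> > 0" "M.mball x0 \<epsilon> \<subseteq> M.mtopology closure_of (C k)"
    by (auto simp: M.in_interior_of_mball)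
  have approx0: "\<exists>c. q c \<le> real k \<and> n (y - c) < r" if "n (x0 - y) < \<epsilon>" "r > 0" for y r
  proof -
    have "y \<in> M.mtopology closure_of (C k)"
      using \<epsilon>(2) that(1) by auto
    then show ?thesis
      using that(2) by (auto simp: M.metric_closure_of C_def)
  qed
  \<comment> \<open>The ball moves from \<open>x0\<close> to \<open>0\<close>: both
    \<open>x0 + y\<close> and \<open>x0 - y\<close> lie in the old ball, and half the difference of
    their approximants approximates \<open>y\<close>.\<close>
  have approx: "\<exists>c. q c \<le> real k \<and> n (y - c) < r" if y: "n y < \<epsilon>" and r: "r > 0" for y r
  proof -
    obtain c where c: "q c \<le> real k" "n (x0 + y - c) < r"
      using approx0[of "x0 + y" r] y r by (auto simp: n.minus)
    obtain c' where c': "q c' \<le> real k" "n (x0 - y - c') < r"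
      using approx0[of "x0 - y" r] y r by auto
    have "y = (1/2) \<odot> (y + y)"
      using n.scale_left_distrib[of "1/2" "1/2" y] by (simp add: n.scale_right_distrib)
    then have "y - (1/2) \<odot> (c - c') = (1/2) \<odot> ((y + y) - (c - c'))"
      by (metis n.scale_right_diff_distrib)
    also have "(y + y) - (c - c') = (x0 + y - c) - (x0 - y - c')"
      by (simp add: algebra_simps)
    finally have "n (y - (1/2) \<odot> (c - c')) < r"
      using n.half_diff[of "x0 + y - c" "x0 - y - c'"] c c' by simp
    moreover have "q ((1/2) \<odot> (c - c')) \<le> real k"
      using q.half_diff[of c c'] c c' by simp
    ultimately show ?thesis by blast
  qed
  have "\<exists>c. q c \<le> (2 * real k / \<epsilon>) * n x \<and> n (x - c) < r" if r: "r > 0" for x r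
  proof (cases "n x = 0")
    case True
    then have "x = 0" by (rule n_eq_0)
    then show ?thesis using r by (intro exI[of _ 0]) simp
  next
    case False
    then have nx: "n x > 0" using n.nonneg[of x] by linarith
    \<comment> \<open>This factor gives \<open>s \<odot> x\<close> norm
      \<open>\<epsilon> / 2\<close>, inside the ball. Scaling back by \<open>1/s\<close> turns
      \<open>k\<close> into \<open>2 * k / \<epsilon> * n x\<close> and the precision
      \<open>s * r\<close> into \<open>r\<close>.\<close>
    define s where "s = \<epsilon> / (2 * n x)"
    have s: "s > 0" "s * n x < \<epsilon>" using nx \<epsilon> by (auto simp: s_def)
    have "n (s \<odot> x) < \<epsilon>" using s by (simp add: n.scale)
    then obtain c where c: "q c \<le> real k" "n (s \<odot> x - c) < s * r"
      using approx[of "s \<odot> x" "s * r"] s r by auto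
    have "x - (1/s) \<odot> c = (1/s) \<odot> (s \<odot> x - c)"
      using s by (simp add: n.scale_right_diff_distrib)
    then have "n (x - (1/s) \<odot> c) = n (s \<odot> x - c) / s"
      using s n.scale[of "1/s" "s \<odot> x - c"]
      by (metis abs_of_pos divide_pos_pos mult.left_neutral times_divide_eq_left zero_less_one)
    then have "n (x - (1/s) \<odot> c) < r"
      using c s by (simp add: pos_divide_less_eq mult.commute)
    moreover have "q ((1/s) \<odot> c) \<le> (2 * real k / \<epsilon>) * n x"
    proof -
      have "q ((1/s) \<odot> c) = q c / s" using s by (simp add: q.scale)
      also have "\<dots> \<le> real k / s" using c s by (simp add: divide_right_mono)
      also have "\<dots> = (2 * real k / \<epsilon>) * n x" using nx \<epsilon> by (simp add: s_def)
      finally show ?thesis .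
    qed
    ultimately show ?thesis by blast
  qed
  moreover have "2 * real k / \<epsilon> \<ge> 0" using \<epsilon> by simp
  ultimately show ?thesis by blast
qed

text \<open>Approximating the successive remainders writes \<open>x\<close> as a series whose
  \<open>q\<close>-values are dominated by a geometric series; countable subadditivity then bounds
  \<open>q x\<close> by its sum.\<close>

theorem Zabreiko:
  fixes scale :: "real \<Rightarrow> 'a::ab_group_add \<Rightarrow> 'a" and n q :: "'a \<Rightarrow> real"
  assumes n: "real_seminorm scale n"
    and n_eq_0: "\<And>x. n x = 0 \<Longrightarrow> x = 0"
    and complete: "\<And>x :: nat \<Rightarrow> 'a.
      (\<And>e. e > 0 \<Longrightarrow> \<exists>M. \<forall>i\<ge>M. \<forall>j\<ge>M. n (x i - x j) < e) \<Longrightarrow> \<exists>l. (\<lambda>i. n (x i - l)) \<longlonglongrightarrow> 0"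
    and q: "real_seminorm scale q"
    and countably_subadditive: "\<And>x s t.
      (\<lambda>m. n ((\<Sum>k<m. x k) - s)) \<longlonglongrightarrow> 0 \<Longrightarrow> (\<lambda>k. q (x k)) sums t \<Longrightarrow> q s \<le> t"
  shows "\<exists>C. \<forall>x. q x \<le> C * n x"
proof -
  interpret n: real_seminorm scale n by (rule n)
  interpret q: real_seminorm scale q by (rule q)
  obtain K where "K \<ge> 0" and "\<forall>x r. r > 0 \<longrightarrow> (\<exists>c. q c \<le> K * n x \<and> n (x - c) < r)"
    using Zabreiko_approximation[OF n n_eq_0 complete q] by blast
  then obtain c where c: "\<And>x r. r > 0 \<Longrightarrow> q (c x r) \<le> K * n x"
      "\<And>x r. r > 0 \<Longrightarrow> n (x - c x r) < r"
    by metis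
  have "q x \<le> (2 * K) * n x" for x
  proof (cases "n x = 0")
    case True
    then have "x = 0" by (rule n_eq_0)
    then show ?thesis by simp
  next
    case False
    then have nx: "n x > 0" using n.nonneg[of x] by linarith
    \<comment> \<open>Target size of the \<open>j\<close>-th remainder. The approximation needs
      positive precision, which is why \<open>n x = 0\<close> is treated separately.\<close>
    define a where "a j = n x * (1/2) ^ j" for j
    have a_pos: "a j > 0" for j using nx by (simp add: a_def)
    \<comment> \<open>Remainders: from \<open>r j\<close> an approximant with error below
      \<open>a (Suc j)\<close> is removed. The shifted index makes \<open>n (r j) \<le> a j\<close>
      hold from \<open>j = 0\<close> on, with equality at the start.\<close>
    define r where "r = rec_nat x (\<lambda>j y. y - c y (a (Suc j)))"
    define d where "d j = c (r j) (a (Suc j))" for j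
    have r_0: "r 0 = x" and r_Suc: "r (Suc j) = r j - d j" for j
      by (simp_all add: r_def d_def)
    have r_le: "n (r j) \<le> a j" for j
    proof (cases j)
      case 0
      then show ?thesis by (simp add: r_0 a_def)
    next
      case (Suc i)
      then show ?thesis
        using c(2)[OF a_pos, of "r i" "Suc i"] by (simp add: r_Suc d_def)
    qed
    have "(\<Sum>j<m. d j) = x - r m" for m
      by (induction m) (simp_all add: r_0 r_Suc)
    then have "n ((\<Sum>j<m. d j) - x) = n (r m)" for m
      by (simp add: n.minus)
    moreover have "(\<lambda>m. n (r m)) \<longlonglongrightarrow> 0"
    proof (rule tendsto_sandwich[OF _ _ tendsto_const])
      show "a \<longlonglongrightarrow> 0"
        unfolding a_def by (intro tendsto_mult_right_zero LIMSEQ_power_zero) simp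
    qed (rule always_eventually, simp add: r_le)+
    ultimately have lim: "(\<lambda>m. n ((\<Sum>j<m. d j) - x)) \<longlonglongrightarrow> 0" by simp
    have q_le: "q (d j) \<le> K * a j" for j
      using c(1)[OF a_pos, of "r j" "Suc j"] mult_left_mono[OF r_le \<open>K \<ge> 0\<close>, of j]
      by (simp add: d_def)
    \<comment> \<open>The powers of \<open>1/2\<close> sum to 2, which is the factor in the final
      constant \<open>2 * K\<close>.\<close>
    have geo: "(\<lambda>j. K * a j) sums (2 * K * n x)"
      using sums_mult[OF geometric_sums[of "1/2::real"], of "K * n x"]
      by (simp add: a_def mult_ac)
    have summable: "summable (\<lambda>j. q (d j))"
      by (rule summable_comparison_test'[OF sums_summable[OF geo]]) (use q_le in auto)
    have "q x \<le> (\<Sum>j. q (d j))"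
      by (rule countably_subadditive[OF lim summable_sums[OF summable]])
    also have "\<dots> \<le> 2 * K * n x"
      using suminf_le[OF q_le summable sums_summable[OF geo]] sums_unique[OF geo] by simp
    finally show ?thesis .
  qed
  then show ?thesis by blast
qed

section \<open>Components of hyperbolic numbers\<close>

text \<open>On \<open>hyperbolics\<close> the idempotent components are real, so \<open>Re\<close>
  loses nothing there; it makes the coordinate a total real-valued map.\<close>

definition hyp1 :: "bicomplex \<Rightarrow> real" where "hyp1 Z = Re (bc_proj1 Z)"
definition hyp2 :: "bicomplex \<Rightarrow> real" where "hyp2 Z = Re (bc_proj2 Z)"

definition hyp_make :: "real \<Rightarrow> real \<Rightarrow> bicomplex" where
  "hyp_make a b = bc_e1 * bc_of_real a + bc_e2 * bc_of_real b"

lemma bc_proj_hyp_make [simp]: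
  "bc_proj1 (hyp_make a b) = of_real a" "bc_proj2 (hyp_make a b) = of_real b"
  by (simp_all add: hyp_make_def bicomplex_defs complex_eq_iff field_simps)

lemma hyp_hyp_make [simp]: "hyp1 (hyp_make a b) = a" "hyp2 (hyp_make a b) = b"
  by (simp_all add: hyp1_def hyp2_def)

lemma hyp_make_in_hyperbolics [simp]: "hyp_make a b \<in> hyperbolics"
  by (simp add: hyperbolics_iff)

lemma bicomplex_eqI: "bc_proj1 Z = bc_proj1 W \<Longrightarrow> bc_proj2 Z = bc_proj2 W \<Longrightarrow> Z = W"
  by (metis bc_idempotent_unique)

lemma hyperbolics_hyp_make: "Z \<in> hyperbolics \<Longrightarrow> hyp_make (hyp1 Z) (hyp2 Z) = Z"
  by (rule bicomplex_eqI) (auto simp: hyperbolics_iff hyp1_def hyp2_def)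

lemma hyperbolics_nonneg_iff:
  "Z \<in> hyperbolics_nonneg \<longleftrightarrow> Z \<in> hyperbolics \<and> 0 \<le> hyp1 Z \<and> 0 \<le> hyp2 Z"
proof
  assume "Z \<in> hyperbolics_nonneg"
  then obtain a b where "Z = hyp_make a b" "0 \<le> a" "0 \<le> b"
    by (auto simp: hyperbolics_nonneg_def hyp_make_def)
  then show "Z \<in> hyperbolics \<and> 0 \<le> hyp1 Z \<and> 0 \<le> hyp2 Z" by simp
next
  assume "Z \<in> hyperbolics \<and> 0 \<le> hyp1 Z \<and> 0 \<le> hyp2 Z"
  then show "Z \<in> hyperbolics_nonneg"
    using hyperbolics_hyp_make[of Z]
    unfolding hyperbolics_nonneg_def hyp_make_def by (metis (mono_tags, lifting) mem_Collect_eq)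
qed

lemma hyp_zero [simp]: "hyp1 0 = 0" "hyp2 0 = 0"
  and hyp_add: "hyp1 (Z + W) = hyp1 Z + hyp1 W" "hyp2 (Z + W) = hyp2 Z + hyp2 W"
  and hyp_diff: "hyp1 (Z - W) = hyp1 Z - hyp1 W" "hyp2 (Z - W) = hyp2 Z - hyp2 W"
  by (simp_all add: hyp1_def hyp2_def bicomplex_defs)

lemma hyp_sum: "hyp1 (sum f A) = (\<Sum>x\<in>A. hyp1 (f x))" "hyp2 (sum f A) = (\<Sum>x\<in>A. hyp2 (f x))"
  by (induction A rule: infinite_finite_induct; simp add: hyp_add)+

lemma bc_abs_k_real: "bc_abs_k (bc_of_real a) = bc_of_real \<bar>a\<bar>"
  by (rule bicomplex_eqI) (simp_all add: bc_abs_k_def bicomplex_defs field_simps)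

lemma hyp_real_mult: "hyp1 (bc_of_real a * Z) = a * hyp1 Z" "hyp2 (bc_of_real a * Z) = a * hyp2 Z"
  by (simp_all add: hyp1_def hyp2_def bicomplex_defs algebra_simps)

lemma zero_in_hyperbolics [simp]: "0 \<in> hyperbolics"
  by (simp add: hyperbolics_iff bicomplex_defs)

lemma add_in_hyperbolics: "Z \<in> hyperbolics \<Longrightarrow> W \<in> hyperbolics \<Longrightarrow> Z + W \<in> hyperbolics"
  using hyperbolics_hyp_make[of Z] hyperbolics_hyp_make[of W]
  by (auto simp: hyperbolics_iff bicomplex_defs complex_is_Real_iff)

lemma sum_in_hyperbolics: "(\<And>x. x \<in> A \<Longrightarrow> f x \<in> hyperbolics) \<Longrightarrow> sum f A \<in> hyperbolics"
  by (induction A rule: infinite_finite_induct) (auto simp: add_in_hyperbolics)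

lemma hyp_le_imp: "hyp_le Z W \<Longrightarrow> hyp1 Z \<le> hyp1 W \<and> hyp2 Z \<le> hyp2 W"
  by (auto simp: hyp_le_def hyperbolics_nonneg_iff hyp_diff)

lemma hyp_tendsto_iff:
  assumes "\<And>x. f x \<in> hyperbolics" "l \<in> hyperbolics"
  shows "hyp_tendsto f l F \<longleftrightarrow>
    ((\<lambda>x. hyp1 (f x)) \<longlongrightarrow> hyp1 l) F \<and> ((\<lambda>x. hyp2 (f x)) \<longlongrightarrow> hyp2 l) F"
proof -
  have "bc_proj1 Z = of_real (hyp1 Z) \<and> bc_proj2 Z = of_real (hyp2 Z)" if "Z \<in> hyperbolics" for Z
    using hyperbolics_hyp_make[OF that] by (metis bc_proj_hyp_make)
  then show ?thesis
    using assms by (simp add: hyp_tendsto_def tendsto_of_real_iff)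
qed

text \<open>For hyperbolic \<open>Z\<close> this is the trace of multiplication by \<open>Z\<close>
  on the real algebra of hyperbolic numbers. It is additive and, on the nonnegative cone, dominates
  both components.\<close>

definition hyp_trace :: "bicomplex \<Rightarrow> real" where "hyp_trace Z = hyp1 Z + hyp2 Z"

text \<open>Each component is squeezed between 0 and the trace. The filter is general so that
  sequences and the product filter of Cauchy sequences are both covered.\<close>

lemma hyp_tendsto_zero_iff:
  assumes "\<And>x. f x \<in> hyperbolics_nonneg"
  shows "hyp_tendsto f 0 F \<longleftrightarrow> ((\<lambda>x. hyp_trace (f x)) \<longlongrightarrow> 0) F"
proof -
  have *: "f x \<in> hyperbolics" "0 \<le> hyp1 (f x)" "0 \<le> hyp2 (f x)" for x
    using assms[of x] by (auto simp: hyperbolics_nonneg_iff)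
  have "((\<lambda>x. hyp1 (f x)) \<longlongrightarrow> 0) F \<and> ((\<lambda>x. hyp2 (f x)) \<longlongrightarrow> 0) F"
    if lim: "((\<lambda>x. hyp_trace (f x)) \<longlongrightarrow> 0) F"
    using * by (intro conjI tendsto_sandwich[OF _ _ tendsto_const lim])
      (auto simp: hyp_trace_def intro!: always_eventually)
  then show ?thesis
    using * by (auto simp: hyp_tendsto_iff hyp_trace_def intro: tendsto_add_zero)
qed

section \<open>Hyperbolic seminorms as real seminorms\<close>

locale hyperbolic_seminormed = module scale
  for scale :: "bicomplex \<Rightarrow> 'a::ab_group_add \<Rightarrow> 'a" +
  fixes p :: "'a \<Rightarrow> bicomplex"
  assumes seminorm: "hyperbolic_seminorm scale p"
begin

lemma in_nonneg: "p x \<in> hyperbolics_nonneg"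
  using seminorm by (simp add: hyperbolic_seminorm_def)

lemma in_hyperbolics: "p x \<in> hyperbolics"
  and hyp_nonneg [simp]: "0 \<le> hyp1 (p x)" "0 \<le> hyp2 (p x)"
  using in_nonneg[of x] by (auto simp: hyperbolics_nonneg_iff)

text \<open>Restriction of scalars along the ring homomorphism \<open>bc_of_real\<close>; over the
  field of reals the module is a vector space.\<close>

lemma module_real: "module (\<lambda>a. scale (bc_of_real a))"
proof
  fix a b :: real and x y :: 'a
  have add: "bc_of_real (a + b) = bc_of_real a + bc_of_real b"
    and mult: "bc_of_real (a * b) = bc_of_real a * bc_of_real b"
    and one: "bc_of_real 1 = 1"
    by (simp_all add: bicomplex_defs)
  show "scale (bc_of_real (a + b)) x = scale (bc_of_real a) x + scale (bc_of_real b) x"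
    by (simp add: add scale_left_distrib)
  show "scale (bc_of_real a) (scale (bc_of_real b) x) = scale (bc_of_real (a * b)) x"
    by (simp add: mult)
  show "scale (bc_of_real 1) x = x"
    by (simp add: one)
  show "scale (bc_of_real a) (x + y) = scale (bc_of_real a) x + scale (bc_of_real a) y"
    by (rule scale_right_distrib)
qed

text \<open>Homogeneity holds because \<open>bc_abs_k\<close> is the ordinary absolute value on real
  scalars. The trace serves for the Zabreiko bound, the components for the final continuity
  argument.\<close>

lemma real_seminorm_hyp:
  shows real_seminorm_hyp1: "real_seminorm (\<lambda>a. scale (bc_of_real a)) (\<lambda>x. hyp1 (p x))"
    and real_seminorm_hyp2: "real_seminorm (\<lambda>a. scale (bc_of_real a)) (\<lambda>x. hyp2 (p x))"
    and real_seminorm_trace: "real_seminorm (\<lambda>a. scale (bc_of_real a)) (\<lambda>x. hyp_trace (p x))"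
proof -
  have hom: "p (scale (bc_of_real a) x) = bc_of_real \<bar>a\<bar> * p x" for a x
    using seminorm by (simp add: hyperbolic_seminorm_def bc_abs_k_real)
  have "hyp_le (p (x + y)) (p x + p y)" for x y
    using seminorm by (simp add: hyperbolic_seminorm_def)
  then have tri: "hyp1 (p (x + y)) \<le> hyp1 (p x) + hyp1 (p y)"
    "hyp2 (p (x + y)) \<le> hyp2 (p x) + hyp2 (p y)" for x y
    using hyp_le_imp hyp_add by metis+
  note vs = module_real[unfolded module_iff_vector_space]
  show "real_seminorm (\<lambda>a. scale (bc_of_real a)) (\<lambda>x. hyp1 (p x))"
    "real_seminorm (\<lambda>a. scale (bc_of_real a)) (\<lambda>x. hyp2 (p x))"
    by (intro real_seminorm.intro vs real_seminorm_axioms.intro; simp add: hom hyp_real_mult tri)+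
  show "real_seminorm (\<lambda>a. scale (bc_of_real a)) (\<lambda>x. hyp_trace (p x))"
    using tri by (intro real_seminorm.intro vs real_seminorm_axioms.intro)
      (simp_all add: hom hyp_real_mult hyp_trace_def distrib_left, smt (verit))
qed

lemma hnorm_tendsto_iff_trace:
  "hnorm_tendsto p x l \<longleftrightarrow> (\<lambda>n. hyp_trace (p (x n - l))) \<longlonglongrightarrow> 0"
  unfolding hnorm_tendsto_def by (rule hyp_tendsto_zero_iff) (rule in_nonneg)

text \<open>The product filter amounts to one common threshold for both indices, which links the
  hyperbolic notion to the real Cauchy condition.\<close>

lemma hnorm_CauchyI:
  assumes "\<And>e. e > 0 \<Longrightarrow> \<exists>M. \<forall>i\<ge>M. \<forall>j\<ge>M. hyp_trace (p (x i - x j)) < e"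
  shows "hnorm_Cauchy p x"
proof -
  have "hyp_trace (p y) \<ge> 0" for y by (simp add: hyp_trace_def)
  then have "((\<lambda>ij. hyp_trace (p (x (fst ij) - x (snd ij)))) \<longlongrightarrow> 0) (sequentially \<times>\<^sub>F sequentially)"
    using assms by (fastforce simp: tendsto_iff eventually_prod_sequentially)
  then show ?thesis
    unfolding hnorm_Cauchy_def case_prod_beta
    by (subst hyp_tendsto_zero_iff) (auto simp: in_nonneg)
qed

text \<open>Both component series are nonnegative and dominated by the trace series, so they
  converge and yield a hyperbolic sum; the order inequality is then added over the
  components.\<close>

lemma trace_countably_subadditive:
  assumes sub: "countably_subadditive N p"
    and s: "hnorm_sums N x s" and t: "(\<lambda>k. hyp_trace (p (x k))) sums t"
  shows "hyp_trace (p s) \<le> t"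
proof -
  have "summable (\<lambda>k. hyp1 (p (x k)))" "summable (\<lambda>k. hyp2 (p (x k)))"
    by (rule summable_comparison_test'[OF sums_summable[OF t]]; simp add: hyp_trace_def)+
  then obtain t1 t2 where t12: "(\<lambda>k. hyp1 (p (x k))) sums t1" "(\<lambda>k. hyp2 (p (x k))) sums t2"
    by (auto simp: summable_def)
  then have "hyp_sums (\<lambda>k. p (x k)) (hyp_make t1 t2)"
    unfolding hyp_sums_def
    by (subst hyp_tendsto_iff) (auto simp: sum_in_hyperbolics in_hyperbolics hyp_sum sums_def)
  then have "hyp_le (p s) (hyp_make t1 t2)"
    using sub s by (auto simp: countably_subadditive_def)
  then have "hyp_trace (p s) \<le> t1 + t2"
    using hyp_le_imp by (fastforce simp: hyp_trace_def)
  also have "t1 + t2 = t"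
    using sums_unique2[OF sums_add[OF t12]] t by (simp add: hyp_trace_def)
  finally show ?thesis .
qed

end

section \<open>From the trace bound to componentwise continuity\<close>

theorem theorem3p4:
  fixes scale :: "bicomplex \<Rightarrow> 'a::ab_group_add \<Rightarrow> 'a"
    and N p :: "'a \<Rightarrow> bicomplex"
  assumes "F_BC_module scale N"
    and "hyperbolic_seminorm scale p"
    and "countably_subadditive N p"
  shows "hnorm_continuous N p"
proof -
  interpret F_BC_module scale N by (rule assms(1))
  interpret N: hyperbolic_seminormed scale N
    by unfold_locales (use hyperbolic_norm in \<open>simp add: hyperbolic_norm_def\<close>)
  interpret p: hyperbolic_seminormed scale p
    by unfold_locales (rule assms(2))
  have N_eq_0: "x = 0" if "hyp_trace (N x) = 0" for x
  proof -
    have "hyp1 (N x) = 0" "hyp2 (N x) = 0"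
      using that N.hyp_nonneg[of x] unfolding hyp_trace_def by linarith+
    then have "N x = 0"
      using hyperbolics_hyp_make[OF N.in_hyperbolics, of x]
        hyperbolics_hyp_make[OF zero_in_hyperbolics] by simp
    then show ?thesis using hyperbolic_norm by (simp add: hyperbolic_norm_def)
  qed
  have "\<exists>C. \<forall>x. hyp_trace (p x) \<le> C * hyp_trace (N x)"
  proof (rule Zabreiko[OF N.real_seminorm_trace N_eq_0 _ p.real_seminorm_trace])
    fix x :: "nat \<Rightarrow> 'a"
    assume "\<And>e. e > 0 \<Longrightarrow> \<exists>M. \<forall>i\<ge>M. \<forall>j\<ge>M. hyp_trace (N (x i - x j)) < e"
    then have "hnorm_Cauchy N x" by (rule N.hnorm_CauchyI)
    then show "\<exists>l. (\<lambda>i. hyp_trace (N (x i - l))) \<longlonglongrightarrow> 0"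
      using complete N.hnorm_tendsto_iff_trace by blast
  next
    fix x s t
    assume "(\<lambda>m. hyp_trace (N ((\<Sum>k<m. x k) - s))) \<longlonglongrightarrow> 0" "(\<lambda>k. hyp_trace (p (x k))) sums t"
    then show "hyp_trace (p s) \<le> t"
      by (intro p.trace_countably_subadditive[OF assms(3)])
        (auto simp: hnorm_sums_def N.hnorm_tendsto_iff_trace)
  qed auto
  then obtain C where C: "\<And>x. hyp_trace (p x) \<le> C * hyp_trace (N x)" by blast
  \<comment> \<open>The other component is nonnegative, so the bound on the sum passes to each
    one.\<close>
  have bound: "hyp1 (p x) \<le> C * hyp_trace (N x)" "hyp2 (p x) \<le> C * hyp_trace (N x)" for x
    using C[of x] p.hyp_nonneg[of x] unfolding hyp_trace_def by linarith+
  show ?thesis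
    unfolding hnorm_continuous_def
  proof (intro allI impI)
    fix x l
    assume "hnorm_tendsto N x l"
    then have lim: "(\<lambda>i. C * hyp_trace (N (x i - l))) \<longlonglongrightarrow> 0"
      by (intro tendsto_mult_right_zero) (simp add: N.hnorm_tendsto_iff_trace)
    show "hyp_tendsto (\<lambda>i. p (x i)) (p l) sequentially"
      using real_seminorm.tendsto_of_bounded[OF p.real_seminorm_hyp1 bound(1) lim]
        real_seminorm.tendsto_of_bounded[OF p.real_seminorm_hyp2 bound(2) lim]
      by (simp add: hyp_tendsto_iff p.in_hyperbolics)
  qed
qed

end
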